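(* Let $r\in\{3,4\}$ and let $T$ be a non-trivial tight $r$-tree. Then there exist constants $c_1,c_2>0$ such that, for every positive integer $n$, $$c_1 n^{r-1}\le R(T,n)\le c_2 n^{r-1}.$$
   Context: An $r$-graph is an $r$-uniform hypergraph (every edge is a set of exactly $r$ vertices). An independent set of an $r$-graph is a set of vertices containing no edge. An $r$-graph $H$ is $F$-free if it has no subgraph (not necessarily induced) isomorphic to $F$. For an $r$-graph $F$, the Ramsey number $R(F,n)$ is the minimum integer $N$ such that every $F$-free $r$-graph on $N$ vertices has an independent set of size $n$. An $r$-graph $T$ is a tight $r$-tree if its edges can be ordered as $e_1,\dots,e_t$ so that for every $i\ge 2$ there exist a vertex $v\in e_i$ and an index $1\le s\le i-1$ such that $v\notin\bigcup_{j=1}^{i-1}e_j$ and $e_i\setminus\{v\}\subset e_s$. A hypergraph $H$ is non-trivial if no vertex is contained in all of its edges, i.e. $\bigcap_{e\in H}e=\emptyset$; otherwise it is trivial. *)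

theory Defs
  imports Complex_Main "HOL-Library.Ramsey"
begin

record 'a hypergraph =
  verts :: "'a set"
  edges :: "'a set set"

definition is_rgraph :: "nat \<Rightarrow> 'a hypergraph \<Rightarrow> bool" where
  "is_rgraph r H \<longleftrightarrow> finite (verts H) \<and> (\<forall>e\<in>edges H. e \<subseteq> verts H \<and> card e = r)"

definition independent_set :: "'a hypergraph \<Rightarrow> 'a set \<Rightarrow> bool" where
  "independent_set H S \<longleftrightarrow> S \<subseteq> verts H \<and> \<not> (\<exists>e\<in>edges H. e \<subseteq> S)"

definition subhypergraph :: "'a hypergraph \<Rightarrow> 'a hypergraph \<Rightarrow> bool" where
  "subhypergraph G H \<longleftrightarrow> verts G \<subseteq> verts H \<and> edges G \<subseteq> edges H"

definition hypergraph_iso :: "'a hypergraph \<Rightarrow> 'b hypergraph \<Rightarrow> bool" where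
  "hypergraph_iso F G \<longleftrightarrow>
     (\<exists>f. bij_betw f (verts F) (verts G) \<and> edges G = (\<lambda>e. f ` e) ` edges F)"

definition hypergraph_free :: "nat \<Rightarrow> 'a hypergraph \<Rightarrow> 'b hypergraph \<Rightarrow> bool" where
  "hypergraph_free r F H \<longleftrightarrow>
     \<not> (\<exists>G. is_rgraph r G \<and> subhypergraph G H \<and> hypergraph_iso F G)"

text \<open>
  Host graphs have their vertices in \<^typ>\<open>nat\<close>; every finite r-graph is isomorphic to such a
  graph. The least number exists by \<open>ramsey_number_exists\<close> below.
\<close>
definition ramsey_property :: "nat \<Rightarrow> 'a hypergraph \<Rightarrow> nat \<Rightarrow> nat \<Rightarrow> bool" where
  "ramsey_property r F n N \<longleftrightarrow>
     (\<forall>H :: nat hypergraph. is_rgraph r H \<and> card (verts H) = N \<and> hypergraph_free r F H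
        \<longrightarrow> (\<exists>S. independent_set H S \<and> card S = n))"

definition ramsey_number :: "nat \<Rightarrow> 'a hypergraph \<Rightarrow> nat \<Rightarrow> nat" where
  "ramsey_number r F n = (LEAST N. ramsey_property r F n N)"

definition tight_tree :: "nat \<Rightarrow> 'a hypergraph \<Rightarrow> bool" where
  "tight_tree r T \<longleftrightarrow> is_rgraph r T \<and>
     (\<exists>es. distinct es \<and> set es = edges T \<and>
        (\<forall>i. 1 \<le> i \<and> i < length es \<longrightarrow>
           (\<exists>v\<in>es ! i. \<exists>s<i. v \<notin> (\<Union>j<i. es ! j) \<and> es ! i - {v} \<subseteq> es ! s)))"

text \<open>
  Since \<^prop>\<open>\<Inter>{} = UNIV\<close>, a hypergraph without edges is trivial.
\<close>
definition nontrivial_hypergraph :: "'a hypergraph \<Rightarrow> bool" where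
  "nontrivial_hypergraph H \<longleftrightarrow> \<Inter>(edges H) = {}"

lemma ramsey_number_exists:
  fixes F :: "'a hypergraph"
  assumes F: "is_rgraph r F"
  shows "\<exists>N. ramsey_property r F n N"
proof -
  define m where "m = card (verts F)"
  obtain N :: nat where N: "partn_lst {..<N} [m, n] r"
    using ramsey_full by blast
  have "\<exists>S. independent_set H S \<and> card S = n"
    if H: "is_rgraph r H" "card (verts H) = N" and free: "hypergraph_free r F H"
    for H :: "nat hypergraph"
  proof -
    have finH: "finite (verts H)" using H by (simp add: is_rgraph_def)
    obtain v where v: "bij_betw v {..<N} (verts H)"
      using bij_betw_from_nat_into_finite finH H(2) by metis
    define c where "c = (\<lambda>e. if v ` e \<in> edges H then 0 else Suc 0)"
    have "c \<in> nsets {..<N} r \<rightarrow> {..<length [m, n]}"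
      by (auto simp: c_def)
    then obtain i where i: "i < 2" "monochromatic {..<N} ([m, n] ! i) r c i"
      using N by (auto simp: partn_lst_def numeral_2_eq_2)
    then obtain A where A: "A \<subseteq> {..<N}" "finite A" "card A = [m, n] ! i"
      and mono: "\<And>e. e \<in> nsets A r \<Longrightarrow> c e = i"
      by (auto simp: monochromatic_def nsets_def image_subset_iff)
    have injA: "inj_on v A" using v A(1) by (meson bij_betw_def inj_on_subset)
    have vA: "v ` A \<subseteq> verts H" using v A(1) by (auto simp: bij_betw_def)
    consider "i = 0" | "i = 1" using i(1) by linarith
    then show ?thesis
    proof cases
      case 1
      have finF: "finite (verts F)" using F by (simp add: is_rgraph_def)
      obtain g where g: "bij_betw g (verts F) A"
        using finF A 1 by (metis finite_same_card_bij m_def nth_Cons_0)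
      define f where "f = v \<circ> g"
      define G where "G = \<lparr>verts = v ` A, edges = (\<lambda>e. f ` e) ` edges F\<rparr>"
      have f: "bij_betw f (verts F) (verts G)"
        unfolding f_def G_def using bij_betw_trans g injA
        by (simp add: bij_betw_trans bij_betw_imageI)
      have e: "f ` e \<in> edges H" "f ` e \<subseteq> v ` A" "card (f ` e) = r" if e: "e \<in> edges F" for e
      proof -
        have e': "e \<subseteq> verts F" "card e = r" using F e by (auto simp: is_rgraph_def)
        have sub: "g ` e \<subseteq> A" using g e'(1) by (auto simp: bij_betw_def)
        have "inj_on g e" using g e'(1) by (meson bij_betw_def inj_on_subset)
        then have "g ` e \<in> nsets A r"
          using sub e' A(2) by (auto simp: nsets_def card_image intro: finite_subset)
        then have "c (g ` e) = 0" using mono 1 by auto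
        then show "f ` e \<in> edges H"
          by (auto simp: c_def f_def image_comp split: if_splits)
        show "f ` e \<subseteq> v ` A" using sub by (auto simp: f_def)
        show "card (f ` e) = r"
          using H(1) \<open>f ` e \<in> edges H\<close> by (auto simp: is_rgraph_def)
      qed
      have "is_rgraph r G" "subhypergraph G H"
        using e vA A(2) by (auto simp: is_rgraph_def subhypergraph_def G_def)
      moreover have "hypergraph_iso F G"
        unfolding hypergraph_iso_def using f by (auto simp: G_def)
      ultimately show ?thesis using free unfolding hypergraph_free_def by blast
    next
      case 2
      have "False" if d: "d \<in> edges H" "d \<subseteq> v ` A" for d
      proof -
        obtain e where e: "e \<subseteq> A" "d = v ` e" using d(2) by (meson subset_imageE)
        have "card d = r" using H(1) d(1) by (auto simp: is_rgraph_def)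
        then have "card e = r"
          using e injA by (metis card_image inj_on_subset)
        then have "c e = 1" using mono 2 e(1) A(2) by (auto simp: nsets_def intro: finite_subset)
        then show False using d(1) e(2) by (simp add: c_def)
      qed
      then have "independent_set H (v ` A)" using vA by (auto simp: independent_set_def)
      moreover have "card (v ` A) = n" using A(3) 2 injA by (simp add: card_image)
      ultimately show ?thesis by blast
    qed
  qed
  then show ?thesis unfolding ramsey_property_def by blast
qed

end

theory Submission
  imports Defs
begin

text \<open>
  For the upper bound, let \<open>H\<close> be a \<open>T\<close>-free \<open>r\<close>-graph on \<open>N\<close> vertices and \<open>k\<close> the number of
  vertices of \<open>T\<close>. If \<open>H\<close> had more than \<open>k\<close> times as many edges as there are \<open>(r - 1)\<close>-sets, then
  repeatedly deleting the edges through an \<open>(r - 1)\<close>-set of small degree would leave a nonempty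
  family in which \<open>T\<close> can be embedded greedily, one edge at a time (\<open>tight_tree_free_few_edges\<close>).
  So \<open>H\<close> has only \<open>O(N ^ (r - 1))\<close> edges, and if \<open>N\<close> is a large multiple of \<open>n ^ (r - 1)\<close>, a set of
  \<open>r * n\<close> vertices with the average number of edges spans at most \<open>n\<close> of them; deleting a vertex
  from each leaves an independent set of size \<open>n\<close> (\<open>sparse_rgraph_independent_set\<close>).

  For the lower bound it suffices to find \<open>r\<close>-graphs on \<open>q ^ (r - 1)\<close> vertices with independence
  number \<open>O(q)\<close> in which every edge contains a distinguished vertex, its centre, such that edges
  sharing \<open>r - 1\<close> vertices have the same centre. Along a tight tree the centre never changes, so all
  edges of any copy of a tight tree share a vertex, and the tree is trivial
  (\<open>no_tree_in_star_components\<close>).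

  For \<open>r = 3\<close> the vertices are the points of a \<open>q \<times> q\<close> grid, and an edge consists of a point,
  a point further right in its row, and a point further up in its column. The centre is the point
  \<open>(min x, min y)\<close>, and any two of the three points already show both minima. A set without
  such a corner consists of points that are last in their row or last in their column, so it has
  at most \<open>2 * q\<close> points.

  For \<open>r = 4\<close> the vertices are the points of a \<open>q \<times> q \<times> q\<close> grid. Each edge consists of a
  centre \<open>p\<close> and three mates \<open>p1\<close>, \<open>p2\<close>, \<open>p3\<close> that agree with \<open>p\<close> in the first, second and third
  coordinate, respectively. In a set of more than \<open>3 * q\<close> points some point has a mate of each
  sort, but in general three of the four points do not determine the centre. The remedy is to insist
  that \<open>p\<close> has minimal \<open>x\<close> (attained also by \<open>p1\<close>) and median \<open>y\<close> (attained also by \<open>p2\<close>): both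
  values are then visible in any three of the four points, and they also tell the mates apart, so
  that \<open>p3\<close> reveals the coordinate \<open>z\<close>. These conditions cost only extremal points: in a set in
  which no two points differ only in \<open>z\<close>, all but \<open>5 * q\<close> points are centres of \<open>cross\<close>
  edges inside the set (\<open>cross_free_card\<close>). Points on a common vertical line are handled by a second kind
  of edges, \<open>line\<close>, consisting of a point, two points above it, and another point at its height. As
  the points of a cross edge lie on different vertical lines, the two kinds share at most two vertices.
\<close>

section \<open>Tight trees in hypergraphs with many edges\<close>

definition shadow :: "nat \<Rightarrow> 'a set set \<Rightarrow> 'a set set" where
  "shadow r F = {A. card A = r - 1 \<and> (\<exists>e\<in>F. A \<subseteq> e)}"

lemma not_free_if_embedding:
  assumes T: "is_rgraph r T" and H: "is_rgraph r H"
    and f: "inj_on f (verts T)" "f ` verts T \<subseteq> verts H" "\<And>e. e \<in> edges T \<Longrightarrow> f ` e \<in> edges H"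
  shows "\<not> hypergraph_free r T H"
proof -
  define G where "G = \<lparr>verts = f ` verts T, edges = (\<lambda>e. f ` e) ` edges T\<rparr>"
  have "is_rgraph r G"
    using T H f(3) by (auto simp: G_def is_rgraph_def)
  moreover have "subhypergraph G H"
    using f by (auto simp: G_def subhypergraph_def)
  moreover have "hypergraph_iso T G"
    unfolding hypergraph_iso_def using f(1) by (intro exI[of _ f]) (simp add: G_def bij_betw_def)
  ultimately show ?thesis
    unfolding hypergraph_free_def by blast
qed

lemma finite_shadow:
  assumes "finite F" "\<And>e. e \<in> F \<Longrightarrow> finite e"
  shows "finite (shadow r F)"
  by (rule finite_subset[of _ "\<Union> (Pow ` F)"]) (use assms in \<open>auto simp: shadow_def\<close>)

text \<open>
  A set of the shadow that lies in at most \<open>k\<close> edges can be removed together with these edges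
  without destroying the assumption: the left-hand side drops by at least \<open>k\<close> and the
  right-hand side by at most \<open>k\<close>. So a smallest subfamily satisfying it has the desired property.
\<close>
lemma subfamily_with_large_codegrees:
  assumes "finite F" "\<And>e. e \<in> F \<Longrightarrow> finite e"
    and "k * card (shadow r F) < card F"
  shows "\<exists>G\<subseteq>F. G \<noteq> {} \<and> (\<forall>A\<in>shadow r G. k < card {e \<in> G. A \<subseteq> e})"
  using assms
proof (induction "card F" arbitrary: F rule: less_induct)
  case less
  show ?case
  proof (cases "\<forall>A\<in>shadow r F. k < card {e \<in> F. A \<subseteq> e}")
    case True
    moreover have "F \<noteq> {}"
      using less.prems(3) by auto
    ultimately show ?thesis by blast
  next
    case False
    then obtain A where A: "A \<in> shadow r F" "card {e \<in> F. A \<subseteq> e} \<le> k"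
      by (auto simp: not_less)
    define D where "D = {e \<in> F. A \<subseteq> e}"
    have D: "D \<subseteq> F" "D \<noteq> {}" "finite D"
      using A(1) less.prems(1) by (auto simp: D_def shadow_def)
    have fin: "finite (shadow r F)"
      using less.prems by (intro finite_shadow) auto
    have "shadow r (F - D) \<subseteq> shadow r F - {A}"
      by (auto simp: shadow_def D_def)
    then have "card (shadow r (F - D)) \<le> card (shadow r F) - 1"
      using fin A(1) by (metis card_Diff_singleton card_mono finite_Diff)
    moreover have "card (shadow r F) > 0"
      using fin A(1) card_gt_0_iff by blast
    ultimately have "card (shadow r (F - D)) + 1 \<le> card (shadow r F)"
      by simp
    then have "k * (card (shadow r (F - D)) + 1) \<le> k * card (shadow r F)"
      by (rule mult_le_mono2)
    then have "k * card (shadow r (F - D)) + k < card F"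
      using less.prems(3) by simp
    then have small: "k * card (shadow r (F - D)) < card (F - D)"
      using A(2) D card_Diff_subset[OF D(3) D(1)] unfolding D_def by linarith
    have "card (F - D) < card F"
      using D less.prems(1) by (intro psubset_card_mono) auto
    then obtain G where "G \<subseteq> F - D" "G \<noteq> {}" "\<forall>A\<in>shadow r G. k < card {e \<in> G. A \<subseteq> e}"
      using less.hyps[of "F - D"] less.prems small by auto
    then show ?thesis by blast
  qed
qed

text \<open>
  The greedy embedding. The image of \<open>es ! i - {v}\<close> lies in the image of an earlier edge, hence in
  the shadow of \<open>G\<close>, hence in more edges of \<open>G\<close> than there are used vertices; so one of
  these edges sends the new vertex \<open>v\<close> to an unused vertex.
\<close>
lemma tight_sequence_embeds:
  fixes es :: "'a set list" and G :: "'b set set"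
  assumes es: "\<And>e. e \<in> set es \<Longrightarrow> finite e \<and> card e = r"
    and tight: "\<And>i. 1 \<le> i \<Longrightarrow> i < length es \<Longrightarrow>
      \<exists>v\<in>es ! i. \<exists>s<i. v \<notin> (\<Union>j<i. es ! j) \<and> es ! i - {v} \<subseteq> es ! s"
    and G: "finite G" "G \<noteq> {}" "\<And>e. e \<in> G \<Longrightarrow> finite e \<and> card e = r"
    and r: "r > 0" and k: "card (\<Union> (set es)) \<le> k"
    and codeg: "\<And>A. A \<in> shadow r G \<Longrightarrow> k < card {e \<in> G. A \<subseteq> e}"
  shows "m \<le> length es \<Longrightarrow> \<exists>f. inj_on f (\<Union>j<m. es ! j) \<and> (\<forall>j<m. f ` (es ! j) \<in> G)"
proof (induction m)
  case 0
  then show ?case by simp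
next
  case (Suc m)
  then have m: "m < length es" by simp
  show ?case
  proof (cases "m = 0")
    case True
    obtain e where e: "e \<in> G" using G(2) by blast
    have e0: "finite (es ! 0)" "card (es ! 0) = r"
      using es m True by auto
    then obtain f where "bij_betw f (es ! 0) e"
      using finite_same_card_bij[of "es ! 0" e] G(3)[OF e] by auto
    then show ?thesis
      using True e by (intro exI[of _ f]) (auto simp: bij_betw_def lessThan_Suc)
  next
    case False
    define U where "U = (\<Union>j<m. es ! j)"
    obtain f where f: "inj_on f U" "\<And>j. j < m \<Longrightarrow> f ` (es ! j) \<in> G"
      using Suc m unfolding U_def by auto
    obtain v s where v: "v \<in> es ! m" "s < m" "v \<notin> U" "es ! m - {v} \<subseteq> es ! s"
      using tight[of m] False m unfolding U_def by auto
    have sub: "es ! m - {v} \<subseteq> U"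
      using v unfolding U_def by blast
    define A where "A = f ` (es ! m - {v})"
    have em: "finite (es ! m)" "card (es ! m) = r"
      using es m by auto
    have cA: "card A = r - 1"
      using em v(1) f(1) sub unfolding A_def by (subst card_image) (auto intro: inj_on_subset)
    have "A \<subseteq> f ` (es ! s)"
      using v(4) unfolding A_def by blast
    then have "A \<in> shadow r G"
      using cA f(2)[OF v(2)] unfolding shadow_def by blast
    then have big: "k < card {e \<in> G. A \<subseteq> e}" by (rule codeg)
    have UU: "U \<subseteq> \<Union> (set es)"
      unfolding U_def
    proof (rule UN_least)
      fix j assume "j \<in> {..<m}"
      then have "es ! j \<in> set es" using m by simp
      then show "es ! j \<subseteq> \<Union> (set es)" by (rule Union_upper)
    qed
    have finUn: "finite (\<Union> (set es))"
      by (rule finite_Union) (use es in auto)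
    have "finite U" by (rule finite_subset[OF UU finUn])
    have "card U \<le> k"
      using card_mono[OF finUn UU] k by simp
    then have "card ((\<lambda>w. insert w A) ` f ` U) \<le> k"
      using card_image_le[OF \<open>finite U\<close>, of "\<lambda>u. insert (f u) A"] by (simp add: image_image)
    then have "\<not> {e \<in> G. A \<subseteq> e} \<subseteq> (\<lambda>w. insert w A) ` f ` U"
      using big card_mono[of "(\<lambda>w. insert w A) ` f ` U" "{e \<in> G. A \<subseteq> e}"] \<open>finite U\<close> by force
    then obtain e where e: "e \<in> G" "A \<subseteq> e" "e \<notin> (\<lambda>w. insert w A) ` f ` U"
      by blast
    have "card (e - A) = 1"
      using G(3)[OF e(1)] e(2) cA r card_Diff_subset[of A e] finite_subset[of A e] by auto
    then obtain w where "e - A = {w}" by (auto simp: card_1_singleton_iff)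
    then have w: "e = insert w A" "w \<notin> A" using e(2) by auto
    have wU: "w \<notin> f ` U" using e(3) w(1) by blast
    define g where "g = f(v := w)"
    have gU: "g x = f x" if "x \<in> U" for x
      using that v(3) unfolding g_def by auto
    have un: "(\<Union>j<Suc m. es ! j) = insert v U"
      using v(1) sub unfolding U_def by (auto simp: lessThan_Suc)
    have "inj_on g (insert v U)"
      using f(1) wU v(3) unfolding g_def by (auto simp: inj_on_def)
    moreover have "g ` (es ! j) \<in> G" if "j < Suc m" for j
    proof (cases "j = m")
      case True
      have "g ` (es ! m) = insert (g v) (g ` (es ! m - {v}))"
        using v(1) by blast
      also have "g ` (es ! m - {v}) = A"
        unfolding A_def by (rule image_cong) (use sub gU in auto)
      finally show ?thesis using True w(1) e(1) unfolding g_def by simp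
    next
      case False
      then have j: "j < m" using that by simp
      then have "es ! j \<subseteq> U" unfolding U_def by blast
      then have "g ` (es ! j) = f ` (es ! j)"
        using gU by (intro image_cong) auto
      then show ?thesis using f(2)[OF j] by simp
    qed
    ultimately show ?thesis unfolding un by blast
  qed
qed

lemma tight_tree_free_few_edges:
  assumes T: "tight_tree r T" and r: "r > 0"
    and H: "is_rgraph r H" and free: "hypergraph_free r T H"
    and large: "card (verts T) \<le> card (verts H)"
  shows "card (edges H) \<le> card (verts T) * (card (verts H) choose (r - 1))"
proof (rule ccontr)
  assume neg: "\<not> ?thesis"
  let ?k = "card (verts T)"
  have finH: "finite (verts H)" and edH: "\<And>e. e \<in> edges H \<Longrightarrow> e \<subseteq> verts H \<and> card e = r \<and> finite e"
    using H by (auto simp: is_rgraph_def intro: finite_subset)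
  have rT: "is_rgraph r T" using T by (simp add: tight_tree_def)
  have finT: "finite (verts T)" and edT: "\<And>e. e \<in> edges T \<Longrightarrow> e \<subseteq> verts T \<and> card e = r \<and> finite e"
    using rT by (auto simp: is_rgraph_def intro: finite_subset)
  have finE: "finite (edges H)"
    by (rule finite_subset[of _ "Pow (verts H)"]) (use edH finH in auto)
  have "shadow r (edges H) \<subseteq> {A. A \<subseteq> verts H \<and> card A = r - 1}"
    using edH unfolding shadow_def by blast
  then have "card (shadow r (edges H)) \<le> card (verts H) choose (r - 1)"
    using n_subsets[OF finH, of "r - 1"] card_mono[of "{A. A \<subseteq> verts H \<and> card A = r - 1}"] finH
    by simp
  then have "?k * card (shadow r (edges H)) \<le> ?k * (card (verts H) choose (r - 1))"
    by (rule mult_le_mono2)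
  then have "?k * card (shadow r (edges H)) < card (edges H)"
    using neg by linarith
  then obtain G where G: "G \<subseteq> edges H" "G \<noteq> {}" "\<forall>A\<in>shadow r G. ?k < card {e \<in> G. A \<subseteq> e}"
    using subfamily_with_large_codegrees[OF finE, of ?k r] edH by auto
  obtain es where es: "set es = edges T"
      "\<forall>i. 1 \<le> i \<and> i < length es \<longrightarrow>
         (\<exists>v\<in>es ! i. \<exists>s<i. v \<notin> (\<Union>j<i. es ! j) \<and> es ! i - {v} \<subseteq> es ! s)"
    using T unfolding tight_tree_def by blast
  define U where "U = \<Union> (edges T)"
  have U: "U \<subseteq> verts T" using edT unfolding U_def by blast
  have "card U \<le> ?k" using card_mono[OF finT U] .
  then have "\<exists>f. inj_on f (\<Union>j<length es. es ! j) \<and> (\<forall>j<length es. f ` (es ! j) \<in> G)"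
    using es edT edH G finite_subset[OF G(1) finE] r
    by (intro tight_sequence_embeds[where r = r and k = ?k]) (auto simp: U_def)
  moreover have "(\<Union>j<length es. es ! j) = U"
    unfolding U_def es(1)[symmetric] by (auto simp: set_conv_nth)
  ultimately obtain f where f: "inj_on f U" "\<And>e. e \<in> edges T \<Longrightarrow> f ` e \<in> G"
    by (metis es(1) in_set_conv_nth)
  have fU: "f ` U \<subseteq> verts H"
    using f(2) G(1) edH unfolding U_def by blast
  have finU: "finite U" using U finT finite_subset by blast
  \<comment> \<open>Vertices of the tree in no edge are sent to arbitrary unused vertices.\<close>
  have "card (verts T - U) \<le> card (verts H - f ` U)"
    using large card_Diff_subset[OF finU U] card_Diff_subset[OF _ fU] card_image[OF f(1)] finU
    by simp
  then obtain g where g: "g ` (verts T - U) \<subseteq> verts H - f ` U" "inj_on g (verts T - U)"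
    using card_le_inj[of "verts T - U" "verts H - f ` U"] finT finH by blast
  define h where "h = (\<lambda>x. if x \<in> U then f x else g x)"
  have "inj_on h (verts T)"
  proof (rule inj_onI)
    fix x y assume xy: "x \<in> verts T" "y \<in> verts T" "h x = h y"
    have "f a \<noteq> g b" if "a \<in> U" "b \<in> verts T - U" for a b
      using g(1) that by blast
    then show "x = y"
      using xy inj_onD[OF f(1), of x y] inj_onD[OF g(2), of x y] unfolding h_def
      by (metis DiffI)
  qed
  moreover have "h ` verts T \<subseteq> verts H"
    using fU g(1) unfolding h_def by auto
  moreover have "h ` e \<in> edges H" if "e \<in> edges T" for e
  proof -
    have "h ` e = f ` e"
      using that unfolding h_def U_def by (intro image_cong) auto
    then show ?thesis using f(2) that G(1) by auto
  qed
  ultimately show False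
    using not_free_if_embedding[OF rT H] free by blast
qed

section \<open>Independent sets in sparse hypergraphs\<close>

lemma card_supersets:
  assumes "finite V" "e \<subseteq> V" "card e \<le> m"
  shows "card {S. e \<subseteq> S \<and> S \<subseteq> V \<and> card S = m} = (card V - card e) choose (m - card e)"
proof -
  have fe: "finite e" using assms finite_subset by blast
  have "bij_betw (\<lambda>S. S - e) {S. e \<subseteq> S \<and> S \<subseteq> V \<and> card S = m} {B. B \<subseteq> V - e \<and> card B = m - card e}"
  proof (rule bij_betwI[where g = "\<lambda>B. B \<union> e"])
    show "(\<lambda>S. S - e) \<in> {S. e \<subseteq> S \<and> S \<subseteq> V \<and> card S = m} \<rightarrow> {B. B \<subseteq> V - e \<and> card B = m - card e}"
      using fe by (auto simp: card_Diff_subset)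
    show "(\<lambda>B. B \<union> e) \<in> {B. B \<subseteq> V - e \<and> card B = m - card e} \<rightarrow> {S. e \<subseteq> S \<and> S \<subseteq> V \<and> card S = m}"
    proof (rule Pi_I)
      fix B assume "B \<in> {B. B \<subseteq> V - e \<and> card B = m - card e}"
      then have B: "B \<subseteq> V - e" "card B = m - card e" by auto
      then have "card (B \<union> e) = m"
        using assms fe finite_subset[of B V] by (subst card_Un_disjoint) auto
      then show "B \<union> e \<in> {S. e \<subseteq> S \<and> S \<subseteq> V \<and> card S = m}"
        using B assms by auto
    qed
  qed auto
  then have "card {S. e \<subseteq> S \<and> S \<subseteq> V \<and> card S = m} = card {B. B \<subseteq> V - e \<and> card B = m - card e}"
    by (rule bij_betw_same_card)
  also have "\<dots> = card (V - e) choose (m - card e)"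
    using assms by (intro n_subsets) auto
  finally show ?thesis using assms fe by (simp add: card_Diff_subset)
qed

text \<open>
  First moment and alteration. An \<open>m\<close>-set of vertices with \<open>m = r * n\<close> contains on average
  \<open>card (edges H) * (m choose r) / (N choose r)\<close> edges, which the size of \<open>N\<close> keeps below \<open>n\<close>.
  Because \<open>r \<ge> 2\<close>, at least \<open>n\<close> vertices survive when a vertex of each of these edges is deleted.
  Taking \<open>m = r * n\<close> and not \<open>2 * n\<close> ensures that an edge fits into an \<open>m\<close>-set.
\<close>
lemma sparse_rgraph_independent_set:
  assumes H: "is_rgraph r H" and r: "2 \<le> r" and n: "n > 0"
    and few: "card (edges H) \<le> k * (card (verts H) choose (r - 1))"
    and large: "k * r ^ Suc r * n ^ (r - 1) + r * n \<le> card (verts H)"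
  shows "\<exists>S. independent_set H S \<and> card S = n"
proof -
  let ?V = "verts H" and ?E = "edges H"
  define N where "N = card ?V"
  define m where "m = r * n"
  define \<S> where "\<S> = {S. S \<subseteq> ?V \<and> card S = m}"
  have finV: "finite ?V" and edH: "\<And>e. e \<in> ?E \<Longrightarrow> e \<subseteq> ?V \<and> card e = r"
    using H by (auto simp: is_rgraph_def)
  have finE: "finite ?E"
    by (rule finite_subset[of _ "Pow ?V"]) (use edH finV in auto)
  have rm: "r \<le> m" and mN: "m \<le> N" using n large by (auto simp: m_def N_def)
  have finS: "finite \<S>" using finV by (simp add: \<S>_def)
  have cS: "card \<S> = N choose m" unfolding \<S>_def N_def by (rule n_subsets[OF finV])
  have "\<exists>S\<in>\<S>. card {e \<in> ?E. e \<subseteq> S} \<le> n"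
  proof (rule ccontr)
    assume "\<not> ?thesis"
    then have "n * card \<S> \<le> (\<Sum>S\<in>\<S>. card {e \<in> ?E. e \<subseteq> S})"
      using sum_bounded_below[of \<S> n "\<lambda>S. card {e \<in> ?E. e \<subseteq> S}"] by (simp add: mult.commute not_le less_imp_le)
    also have "\<dots> = (\<Sum>S\<in>\<S>. \<Sum>e\<in>?E. if e \<subseteq> S then 1 else 0)"
      using finE by (simp add: sum.If_cases Int_def)
    also have "\<dots> = (\<Sum>e\<in>?E. \<Sum>S\<in>\<S>. if e \<subseteq> S then 1 else 0)"
      by (rule sum.swap)
    also have "\<dots> = (\<Sum>e\<in>?E. (N - r) choose (m - r))"
    proof (rule sum.cong)
      fix e assume e: "e \<in> ?E"
      have "(\<Sum>S\<in>\<S>. if e \<subseteq> S then 1 else 0) = card {S \<in> \<S>. e \<subseteq> S}"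
        using finS by (simp add: sum.If_cases Int_def)
      also have "{S \<in> \<S>. e \<subseteq> S} = {S. e \<subseteq> S \<and> S \<subseteq> ?V \<and> card S = m}"
        by (auto simp: \<S>_def)
      finally show "(\<Sum>S\<in>\<S>. if e \<subseteq> S then 1 else 0) = (N - r) choose (m - r)"
        using card_supersets[OF finV, of e m] edH[OF e] rm by (simp add: N_def)
    qed simp
    also have "\<dots> = card ?E * ((N - r) choose (m - r))" by simp
    also have "\<dots> \<le> k * (N choose (r - 1)) * ((N - r) choose (m - r))"
      using few by (simp add: N_def)
    finally have 1: "n * (N choose m) \<le> k * (N choose (r - 1)) * ((N - r) choose (m - r))"
      by (simp add: cS)
    define D where "D = (N - r) choose (m - r)"
    have "n * (N choose r) * D = n * (N choose m) * (m choose r)"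
      using choose_mult[OF rm mN] by (simp add: D_def)
    also have "\<dots> \<le> k * (N choose (r - 1)) * D * (m choose r)"
      using 1 by (simp add: D_def)
    finally have "D * (n * (N choose r)) \<le> D * (k * (N choose (r - 1)) * (m choose r))"
      by (simp add: ac_simps)
    moreover have "D > 0" using rm mN by (simp add: D_def)
    ultimately have 2: "n * (N choose r) \<le> k * (N choose (r - 1)) * (m choose r)"
      by simp
    define B where "B = N choose (r - 1)"
    have "r * (N choose r) = (N - (r - 1)) * B"
      using binomial_absorption[of "r - 1" N] binomial_absorb_comp[of N "r - 1"] r
      by (simp add: B_def)
    then have "B * (n * (N - (r - 1))) = r * (n * (N choose r))"
      by (simp add: ac_simps)
    also have "\<dots> \<le> r * (k * B * (m choose r))"
      using 2 by (intro mult_le_mono2) (simp add: B_def)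
    finally have "B * (n * (N - (r - 1))) \<le> B * (k * r * (m choose r))"
      by (simp add: ac_simps)
    moreover have "B > 0" using rm mN by (simp add: B_def)
    ultimately have "n * (N - (r - 1)) \<le> k * r * (m choose r)" by simp
    also have "\<dots> \<le> k * r * m ^ r"
      using binomial_le_pow[OF rm] by simp
    also have "\<dots> = n * (k * r ^ Suc r * n ^ (r - 1))"
    proof -
      have "m ^ r = r ^ r * (n * n ^ (r - 1))"
        using r power_minus_mult[of r n] by (simp add: m_def power_mult_distrib mult.commute)
      then show ?thesis by (simp add: ac_simps)
    qed
    finally have "N - (r - 1) \<le> k * r ^ Suc r * n ^ (r - 1)"
      using n by simp
    moreover have "r \<le> r * n" using n by simp
    ultimately show False
      using large r unfolding N_def by linarith
  qed
  then obtain S where S: "S \<subseteq> ?V" "card S = m" "card {e \<in> ?E. e \<subseteq> S} \<le> n"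
    by (auto simp: \<S>_def)
  define W where "W = (\<lambda>e. SOME v. v \<in> e) ` {e \<in> ?E. e \<subseteq> S}"
  have W: "(SOME v. v \<in> e) \<in> e" if "e \<in> ?E" for e
    using edH[OF that] r by (intro some_in_eq[THEN iffD2]) auto
  have finW: "finite W" using finE by (simp add: W_def)
  have "card W \<le> card {e \<in> ?E. e \<subseteq> S}"
    unfolding W_def using finE by (intro card_image_le) simp
  then have "card W \<le> n" using S(3) by simp
  moreover have "2 * n \<le> m" using r by (simp add: m_def)
  ultimately have "n \<le> card (S - W)"
    using S(2) diff_card_le_card_Diff[OF finW, of S] by linarith
  then obtain S' where S': "S' \<subseteq> S - W" "card S' = n"
    using obtain_subset_with_card_n by blast
  have "\<not> e \<subseteq> S'" if "e \<in> ?E" for e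
    using W[OF that] S'(1) that unfolding W_def by blast
  then have "independent_set H S'"
    using S' S unfolding independent_set_def by blast
  then show ?thesis using S'(2) by blast
qed

section \<open>Hypergraphs whose tight components are stars\<close>

text \<open>
  \<open>C p e\<close> means that \<open>p\<close> is the centre of the edge \<open>e\<close>. As \<open>e\<close> may equal \<open>e'\<close>, the centre is
  unique; it is constant on tight components, so each of these is a star. The centre is a relation
  rather than a function of the edge because it is read off from a presentation of the edge.
\<close>
definition star_components :: "nat \<Rightarrow> 'a hypergraph \<Rightarrow> bool" where
  "star_components r H \<longleftrightarrow> (\<exists>C. (\<forall>e\<in>edges H. \<exists>p\<in>e. C p e) \<and>
     (\<forall>e\<in>edges H. \<forall>e'\<in>edges H. \<forall>p p'.
        C p e \<longrightarrow> C p' e' \<longrightarrow> r \<le> Suc (card (e \<inter> e')) \<longrightarrow> p = p'))"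

text \<open>
  Consecutive attachments of a tight tree share \<open>r - 1\<close> vertices, so by induction along the tree all
  edges of a copy have the same centre. Its preimage is a vertex common to all edges of \<open>T\<close>.
\<close>
lemma no_tree_in_star_components:
  assumes H: "star_components r H" and T: "tight_tree r T" and nt: "nontrivial_hypergraph T"
    and r: "r > 0"
    and f: "inj_on f (verts T)" "\<And>e. e \<in> edges T \<Longrightarrow> f ` e \<in> edges H"
  shows False
proof -
  from H obtain C where ex: "\<forall>e\<in>edges H. \<exists>p\<in>e. C p e"
    and uniq: "\<forall>e\<in>edges H. \<forall>e'\<in>edges H. \<forall>p p'.
        C p e \<longrightarrow> C p' e' \<longrightarrow> r \<le> Suc (card (e \<inter> e')) \<longrightarrow> p = p'"
    unfolding star_components_def by (elim exE conjE)
  note C = ex[rule_format] uniq[rule_format]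
  have edT: "\<And>e. e \<in> edges T \<Longrightarrow> e \<subseteq> verts T \<and> card e = r"
    using T by (auto simp: tight_tree_def is_rgraph_def)
  obtain es where es: "set es = edges T"
      "\<forall>i. 1 \<le> i \<and> i < length es \<longrightarrow>
         (\<exists>v\<in>es ! i. \<exists>s<i. v \<notin> (\<Union>j<i. es ! j) \<and> es ! i - {v} \<subseteq> es ! s)"
    using T unfolding tight_tree_def by blast
  have "edges T \<noteq> {}"
    using nt by (auto simp: nontrivial_hypergraph_def)
  then have len: "length es > 0" using es(1) by auto
  have ed: "es ! i \<in> edges T" if "i < length es" for i
    using nth_mem[OF that] unfolding es(1) .
  obtain p where p: "p \<in> f ` (es ! 0)" "C p (f ` (es ! 0))"
    using C(1)[OF f(2)[OF ed[OF len]]] by blast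
  have all: "i < length es \<Longrightarrow> p \<in> f ` (es ! i) \<and> C p (f ` (es ! i))" for i
  proof (induction i rule: less_induct)
    case (less i)
    show ?case
    proof (cases "i = 0")
      case False
      then have "\<exists>v\<in>es ! i. \<exists>s<i. v \<notin> (\<Union>j<i. es ! j) \<and> es ! i - {v} \<subseteq> es ! s"
        using es(2) less.prems by simp
      then obtain v s where v: "v \<in> es ! i" "s < i" "es ! i - {v} \<subseteq> es ! s"
        by blast
      have s: "C p (f ` (es ! s))" "f ` (es ! s) \<in> edges H"
        using less.IH[OF v(2)] less.prems v(2) f(2) ed by auto
      have i: "f ` (es ! i) \<in> edges H" using f(2) ed less.prems by blast
      obtain p' where p': "p' \<in> f ` (es ! i)" "C p' (f ` (es ! i))"
        using C(1)[OF i] by blast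
      have fin: "finite (es ! i)" and ci: "card (es ! i) = r"
        using edT[OF ed[OF less.prems]] r by (auto intro: card_ge_0_finite)
      have inj: "inj_on f (es ! i - {v})"
        using f(1) edT[OF ed[OF less.prems]] by (auto intro: inj_on_subset)
      have "r - 1 = card (f ` (es ! i - {v}))"
        using card_image[OF inj] fin ci v(1) by simp
      also have "\<dots> \<le> card (f ` (es ! i) \<inter> f ` (es ! s))"
        using v(3) fin by (intro card_mono) auto
      finally have "r \<le> Suc (card (f ` (es ! i) \<inter> f ` (es ! s)))" by simp
      then have "p' = p" using C(2)[OF i s(2) p'(2) s(1)] by simp
      then show ?thesis using p' by simp
    qed (use p in simp)
  qed
  obtain u where u: "u \<in> es ! 0" "p = f u" using p(1) by blast
  have "u \<in> e" if "e \<in> edges T" for e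
  proof -
    have "e \<in> set es" using that unfolding es(1) .
    then obtain i where i: "i < length es" "e = es ! i"
      unfolding in_set_conv_nth by blast
    then have "f u \<in> f ` e" using all[OF i(1)] u(2) by simp
    then obtain w where w: "f u = f w" "w \<in> e" by (rule imageE)
    then have "u = w"
      using inj_onD[OF f(1) w(1)] edT[OF that] edT[OF ed[OF len]] u(1) by blast
    then show ?thesis using w(2) by simp
  qed
  then show False
    using nt unfolding nontrivial_hypergraph_def by blast
qed

text \<open>
  Passing to an induced subhypergraph keeps the components stars and cannot create larger
  independent sets. This is why \<open>H\<close> refutes \<open>ramsey_property\<close> for every number up to
  \<open>card (verts H)\<close>, and not just for that number itself.
\<close>
lemma ramsey_number_gt:
  assumes H: "is_rgraph r H" "star_components r H"
    and indep: "\<And>S. independent_set H S \<Longrightarrow> card S < n"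
    and T: "tight_tree r T" "nontrivial_hypergraph T" and r: "r > 0"
  shows "card (verts H) < ramsey_number r T n"
proof (rule ccontr)
  define N where "N = ramsey_number r T n"
  assume "\<not> ?thesis"
  then have N: "N \<le> card (verts H)" by (simp add: N_def)
  have "is_rgraph r T" using T by (simp add: tight_tree_def)
  then have holds: "ramsey_property r T n N"
    unfolding N_def ramsey_number_def by (rule LeastI_ex[OF ramsey_number_exists])
  obtain W where W: "W \<subseteq> verts H" "card W = N" "finite W"
    using obtain_subset_with_card_n[OF N] by blast
  then obtain g where g: "bij_betw g {..<N} W"
    using bij_betw_from_nat_into_finite by blast
  then have inj: "inj_on g {..<N}" and img: "g ` {..<N} = W" by (auto simp: bij_betw_def)
  define H' where "H' = \<lparr>verts = {..<N}, edges = {e. e \<subseteq> {..<N} \<and> g ` e \<in> edges H}\<rparr>"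
  have card_g: "card (g ` e) = card e" if "e \<subseteq> {..<N}" for e
    using inj that by (auto intro: card_image inj_on_subset)
  have H': "is_rgraph r H'"
    using H(1) card_g by (fastforce simp: is_rgraph_def H'_def)
  have "hypergraph_free r T H'"
    unfolding hypergraph_free_def
  proof
    assume "\<exists>G. is_rgraph r G \<and> subhypergraph G H' \<and> hypergraph_iso T G"
    then obtain G f where G: "subhypergraph G H'" "bij_betw f (verts T) (verts G)"
      "edges G = (\<lambda>e. f ` e) ` edges T"
      unfolding hypergraph_iso_def by blast
    have "f ` verts T \<subseteq> {..<N}"
      using G by (auto simp: subhypergraph_def H'_def bij_betw_def)
    then have "inj_on (g \<circ> f) (verts T)"
      using G(2) inj by (intro comp_inj_on) (auto simp: bij_betw_def intro: inj_on_subset)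
    moreover have "(g \<circ> f) ` e \<in> edges H" if "e \<in> edges T" for e
      using G that by (auto simp: subhypergraph_def H'_def image_comp)
    ultimately show False
      by (rule no_tree_in_star_components[OF H(2) T r])
  qed
  then obtain S where S: "independent_set H' S" "card S = n"
    using holds H' unfolding ramsey_property_def by (auto simp: H'_def)
  then have SN: "S \<subseteq> {..<N}" by (simp add: independent_set_def H'_def)
  have "independent_set H (g ` S)"
    unfolding independent_set_def
  proof (intro conjI notI)
    show "g ` S \<subseteq> verts H" using SN img W(1) by blast
    assume "\<exists>e\<in>edges H. e \<subseteq> g ` S"
    then obtain e where e: "e \<in> edges H" "e \<subseteq> g ` S" by blast
    then obtain e' where "e' \<subseteq> S" "e = g ` e'" by (meson subset_imageE)
    then have "e' \<in> edges H'" "e' \<subseteq> S" using e(1) SN by (auto simp: H'_def)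
    then show False using S(1) unfolding independent_set_def by blast
  qed
  then show False
    using indep[of "g ` S"] card_g[OF SN] S(2) by simp
qed

text \<open>
  A minimum attained twice survives the deletion of any one vertex, so it can be read off from the
  common part of the two edges.
\<close>
lemma shared_minimum:
  fixes k :: "'a \<Rightarrow> 'b::linorder"
  assumes e: "finite e" "card e = r" and e': "finite e'" "card e' = r"
    and r: "r \<le> Suc (card (e \<inter> e'))"
    and p: "\<And>a. a \<in> e \<Longrightarrow> k p \<le> k a" "2 \<le> card {a \<in> e. k a = k p}"
    and p': "\<And>a. a \<in> e' \<Longrightarrow> k p' \<le> k a" "2 \<le> card {a \<in> e'. k a = k p'}"
  shows "k p = k p'"
proof -
  have meet: "D \<inter> (c \<inter> c') \<noteq> {}"
    if "D \<subseteq> c" "2 \<le> card D" "finite c" "card c = r" "r \<le> Suc (card (c \<inter> c'))" for D c c' :: "'a set"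
  proof
    assume "D \<inter> (c \<inter> c') = {}"
    then have "card D + card (c \<inter> c') = card (D \<union> (c \<inter> c'))"
      using that by (intro card_Un_disjoint[symmetric]) (auto intro: finite_subset)
    also have "\<dots> \<le> card c"
      using that by (intro card_mono) auto
    finally show False using that by simp
  qed
  have "{a \<in> e. k a = k p} \<inter> (e \<inter> e') \<noteq> {}"
    using e r p by (intro meet) auto
  moreover have "{a \<in> e'. k a = k p'} \<inter> (e' \<inter> e) \<noteq> {}"
    using e' r p' by (intro meet) (auto simp: Int_commute)
  ultimately obtain a b where "a \<in> e \<inter> e'" "k a = k p" "b \<in> e \<inter> e'" "k b = k p'"
    by blast
  then show ?thesis using p(1)[of b] p'(1)[of a] by simp
qed

text \<open>
  If three of four values are at most \<open>m\<close> and three are at least \<open>m\<close>, then in any three of the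
  values \<open>m\<close> is the median. The assumptions hold for a value attained twice with the other two on
  opposite sides, and for a value attained three times.
\<close>
lemma shared_median:
  fixes k :: "'a \<Rightarrow> 'b::linorder"
  assumes e: "finite e" "card e = 4" and e': "finite e'" "card e' = 4"
    and r: "3 \<le> card (e \<inter> e')"
    and p: "3 \<le> card {a \<in> e. k a \<le> k p}" "3 \<le> card {a \<in> e. k p \<le> k a}"
    and p': "3 \<le> card {a \<in> e'. k a \<le> k p'}" "3 \<le> card {a \<in> e'. k p' \<le> k a}"
  shows "k p = k p'"
proof -
  have le: "k q \<le> k q'"
    if "finite c" "card c = 4" "finite c'" "card c' = 4" "3 \<le> card (c \<inter> c')"
      "3 \<le> card {a \<in> c'. k a \<le> k q'}" "3 \<le> card {a \<in> c. k q \<le> k a}" for c c' q q'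
  proof (rule ccontr)
    assume "\<not> k q \<le> k q'"
    then have disj: "{a \<in> c'. k a \<le> k q'} \<inter> {a \<in> c. k q \<le> k a} = {}" by auto
    have "card ({a \<in> c'. k a \<le> k q'} \<union> {a \<in> c. k q \<le> k a}) \<le> card (c \<union> c')"
      using that by (intro card_mono) auto
    moreover have "card (c \<union> c') + card (c \<inter> c') = card c + card c'"
      using that by (intro card_Un_Int[symmetric])
    ultimately show False
      using that card_Un_disjoint[OF _ _ disj] by simp
  qed
  show ?thesis
  proof (rule antisym)
    show "k p \<le> k p'" by (rule le[OF e e' r p'(1) p(2)])
    have "3 \<le> card (e' \<inter> e)" using r by (simp add: Int_commute)
    then show "k p' \<le> k p" by (rule le[OF e' e _ p(1) p'(2)])
  qed
qed

text \<open>
  Discarding the extremal points of all rows, columns or slices costs one point for each of them.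
  Of two points without \<open>R\<close>-successor in the same fibre of \<open>f\<close>, one would succeed the other.
\<close>
lemma card_fibre_maximal_le:
  assumes "finite S" "f ` S \<subseteq> C" "finite C"
    and total: "\<And>a b. a \<in> S \<Longrightarrow> b \<in> S \<Longrightarrow> a \<noteq> b \<Longrightarrow> f a = f b \<Longrightarrow> R a b \<or> R b a"
  shows "card {p \<in> S. \<not> (\<exists>s\<in>S. f s = f p \<and> R p s)} \<le> card C"
proof (rule card_inj_on_le[where f = f])
  show "inj_on f {p \<in> S. \<not> (\<exists>s\<in>S. f s = f p \<and> R p s)}"
    using total by (intro inj_onI) (metis (mono_tags, lifting) mem_Collect_eq)
qed (use assms in auto)

section \<open>The construction for triples\<close>

definition corner_hypergraph :: "nat \<Rightarrow> (nat \<times> nat) hypergraph" where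
  "corner_hypergraph q = \<lparr>verts = {..<q} \<times> {..<q},
     edges = {{(x, y), (x', y), (x, y')} | x y x' y'. x < x' \<and> x' < q \<and> y < y' \<and> y' < q}\<rparr>"

lemma corner_is_rgraph: "is_rgraph 3 (corner_hypergraph q)"
  by (auto simp: is_rgraph_def corner_hypergraph_def card_insert_if)

lemma corner_star_components: "star_components 3 (corner_hypergraph q)"
proof -
  define C where "C p e \<longleftrightarrow> p \<in> e \<and> finite e \<and> card e = 3 \<and>
      (\<forall>a\<in>e. fst p \<le> fst a) \<and> 2 \<le> card {a \<in> e. fst a = fst p} \<and>
      (\<forall>a\<in>e. snd p \<le> snd a) \<and> 2 \<le> card {a \<in> e. snd a = snd p}"
    for p :: "nat \<times> nat" and e
  show ?thesis
    unfolding star_components_def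
  proof (intro exI[of _ C] conjI ballI allI impI)
    fix e assume "e \<in> edges (corner_hypergraph q)"
    then obtain x y x' y' where e: "e = {(x, y), (x', y), (x, y')}" "x < x'" "y < y'"
      by (auto simp: corner_hypergraph_def)
    have "{a \<in> e. fst a = x} = {(x, y), (x, y')}" "{a \<in> e. snd a = y} = {(x, y), (x', y)}"
      using e by auto
    then have "C (x, y) e"
      using e by (auto simp: C_def)
    then show "\<exists>p\<in>e. C p e" using e by blast
  next
    fix e e' p p'
    assume "C p e" "C p' e'" and r: "3 \<le> Suc (card (e \<inter> e'))"
    then show "p = p'"
      using shared_minimum[of e 3 e' fst p p'] shared_minimum[of e 3 e' snd p p']
      unfolding C_def by (auto intro: prod_eqI)
  qed
qed

lemma corner_independent_card:
  assumes "independent_set (corner_hypergraph q) S"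
  shows "card S \<le> 2 * q"
proof -
  have S: "S \<subseteq> {..<q} \<times> {..<q}" using assms by (simp add: independent_set_def corner_hypergraph_def)
  then have fin: "finite S" by (rule finite_subset) simp
  define A where "A = {p \<in> S. \<not> (\<exists>s\<in>S. snd s = snd p \<and> fst p < fst s)}"
  define B where "B = {p \<in> S. \<not> (\<exists>s\<in>S. fst s = fst p \<and> snd p < snd s)}"
  have "card A \<le> card {..<q}" "card B \<le> card {..<q}"
    unfolding A_def B_def using S fin
    by (intro card_fibre_maximal_le; auto simp: prod_eq_iff)+
  moreover have "S \<subseteq> A \<union> B"
  proof
    fix p assume p: "p \<in> S"
    show "p \<in> A \<union> B"
    proof (rule ccontr)
      assume "p \<notin> A \<union> B"
      then obtain s t where st: "s \<in> S" "snd s = snd p" "fst p < fst s"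
        "t \<in> S" "fst t = fst p" "snd p < snd t"
        using p by (auto simp: A_def B_def)
      have p_eq: "p = (fst p, snd p)" "s = (fst s, snd p)" "t = (fst p, snd t)"
        using st by (simp_all add: prod_eq_iff)
      have "fst s < q" "snd t < q" using S st by (auto simp: mem_Times_iff)
      then have "{(fst p, snd p), (fst s, snd p), (fst p, snd t)} \<in> edges (corner_hypergraph q)"
        using st unfolding corner_hypergraph_def hypergraph.simps by blast
      then have "{p, s, t} \<in> edges (corner_hypergraph q)"
        using p_eq by simp
      moreover have "{p, s, t} \<subseteq> S" using st p by simp
      ultimately show False using assms by (auto simp: independent_set_def)
    qed
  qed
  then have "card S \<le> card (A \<union> B)"
    using fin by (intro card_mono) (auto simp: A_def B_def)
  ultimately show ?thesis using card_Un_le[of A B] by simp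
qed

section \<open>The construction for quadruples\<close>

type_synonym point = "nat \<times> nat \<times> nat"

abbreviation xc :: "point \<Rightarrow> nat" where "xc p \<equiv> fst p"
abbreviation yc :: "point \<Rightarrow> nat" where "yc p \<equiv> fst (snd p)"
abbreviation zc :: "point \<Rightarrow> nat" where "zc p \<equiv> snd (snd p)"

text \<open>
  The first two disjuncts are the generic case, where \<open>yc p\<close> lies strictly between the values of
  \<open>p1\<close> and \<open>p3\<close>. In the first one \<open>p3\<close> may have the same first coordinate as \<open>p\<close> and \<open>p1\<close>; the
  strict inequality in the second one keeps \<open>p1\<close> and \<open>p3\<close> distinguishable, since of two mates
  with minimal first coordinate on either side of \<open>yc p\<close> it makes the upper one \<open>p3\<close>. The third
  disjunct serves points whose mates in the slice of their third coordinate all lie in a row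
  parallel to the first axis. There \<open>p2\<close> and \<open>p3\<close> both have the median second coordinate and
  cannot be told apart, so both have to lie in that row and reveal the same \<open>zc p\<close>.
\<close>
definition cross :: "point \<Rightarrow> point \<Rightarrow> point \<Rightarrow> point \<Rightarrow> bool" where
  "cross p p1 p2 p3 \<longleftrightarrow> xc p1 = xc p \<and> yc p2 = yc p \<and> zc p3 = zc p \<and>
     xc p < xc p2 \<and> xc p \<le> xc p3 \<and>
     (yc p1 < yc p \<and> yc p < yc p3 \<or>
      yc p3 < yc p \<and> yc p < yc p1 \<and> xc p < xc p3 \<or>
      yc p3 = yc p \<and> yc p1 \<noteq> yc p \<and> zc p2 = zc p \<and> xc p2 < xc p3)"

definition line :: "point \<Rightarrow> point \<Rightarrow> point \<Rightarrow> point \<Rightarrow> bool" where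
  "line p p1 p2 p3 \<longleftrightarrow> xc p1 = xc p \<and> yc p1 = yc p \<and> xc p2 = xc p \<and> yc p2 = yc p \<and>
     zc p < zc p1 \<and> zc p1 < zc p2 \<and> zc p3 = zc p \<and> p3 \<noteq> p"

definition grid_hypergraph :: "nat \<Rightarrow> point hypergraph" where
  "grid_hypergraph q = \<lparr>verts = {..<q} \<times> {..<q} \<times> {..<q},
     edges = {{p, p1, p2, p3} | p p1 p2 p3.
       {p, p1, p2, p3} \<subseteq> {..<q} \<times> {..<q} \<times> {..<q} \<and> (cross p p1 p2 p3 \<or> line p p1 p2 p3)}\<rparr>"

lemma cross_inj:
  assumes "cross p p1 p2 p3"
  shows "inj_on (\<lambda>a. (xc a, yc a)) {p, p1, p2, p3}"
  using assms unfolding cross_def by auto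

lemma cross_card:
  assumes "cross p p1 p2 p3"
  shows "card {p, p1, p2, p3} = 4"
  using assms unfolding cross_def by (auto simp: card_insert_if)

lemma line_card:
  assumes "line p p1 p2 p3"
  shows "card {p, p1, p2, p3} = 4"
  using assms unfolding line_def by (auto simp: card_insert_if)

lemma two_le_card:
  assumes "finite D" "{a, b} \<subseteq> D" "a \<noteq> b"
  shows "2 \<le> card D"
  using card_mono[OF assms(1,2)] assms(3) by simp

lemma three_le_card:
  assumes "finite D" "{a, b, c} \<subseteq> D" "card {a, b, c} = 3"
  shows "3 \<le> card D"
  using card_mono[OF assms(1,2)] assms(3) by simp

lemma cross_centre_position:
  assumes "cross p p1 p2 p3"
  defines "e \<equiv> {p, p1, p2, p3}"
  shows "\<And>a. a \<in> e \<Longrightarrow> xc p \<le> xc a" "2 \<le> card {a \<in> e. xc a = xc p}"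
    "3 \<le> card {a \<in> e. yc a \<le> yc p}" "3 \<le> card {a \<in> e. yc p \<le> yc a}"
proof -
  have c: "cross p p1 p2 p3" by fact
  have d: "p \<noteq> p1" "p \<noteq> p2" "p \<noteq> p3" "p1 \<noteq> p2" "p1 \<noteq> p3" "p2 \<noteq> p3"
    using c unfolding cross_def by auto
  show "xc p \<le> xc a" if "a \<in> e" for a
    using that c unfolding e_def cross_def by auto
  show "2 \<le> card {a \<in> e. xc a = xc p}"
    by (rule two_le_card[of _ p p1]) (use c d in \<open>auto simp: e_def cross_def\<close>)
  show "3 \<le> card {a \<in> e. yc a \<le> yc p}"
  proof (cases "yc p1 < yc p")
    case True
    then show ?thesis
      by (intro three_le_card[of _ p p2 p1]) (use c d in \<open>auto simp: e_def cross_def card_insert_if\<close>)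
  next
    case False
    then show ?thesis
      by (intro three_le_card[of _ p p2 p3]) (use c d in \<open>auto simp: e_def cross_def card_insert_if\<close>)
  qed
  show "3 \<le> card {a \<in> e. yc p \<le> yc a}"
  proof (cases "yc p < yc p1")
    case True
    then show ?thesis
      by (intro three_le_card[of _ p p2 p1]) (use c d in \<open>auto simp: e_def cross_def card_insert_if\<close>)
  next
    case False
    then show ?thesis
      by (intro three_le_card[of _ p p2 p3]) (use c d in \<open>auto simp: e_def cross_def card_insert_if\<close>)
  qed
qed

lemma line_centre_position:
  assumes "line p p1 p2 p3"
  defines "e \<equiv> {p, p1, p2, p3}"
  shows "\<And>a. a \<in> e \<Longrightarrow> zc p \<le> zc a" "2 \<le> card {a \<in> e. zc a = zc p}"
    "3 \<le> card {a \<in> e. xc a = xc p \<and> yc a = yc p}"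
proof -
  have l: "line p p1 p2 p3" by fact
  show "zc p \<le> zc a" if "a \<in> e" for a
    using that l unfolding e_def line_def by auto
  show "2 \<le> card {a \<in> e. zc a = zc p}"
    by (rule two_le_card[of _ p p3]) (use l in \<open>auto simp: e_def line_def\<close>)
  show "3 \<le> card {a \<in> e. xc a = xc p \<and> yc a = yc p}"
    by (rule three_le_card[of _ p p1 p2]) (use l in \<open>auto simp: e_def line_def card_insert_if\<close>)
qed

text \<open>
  By \<open>shared_minimum\<close> and \<open>shared_median\<close> the two centres agree in the first two coordinates, which
  by \<open>cross_inj\<close> settles the matter if one of them lies in both edges. Otherwise the common points
  are the three mates of either centre. The first mate is off the median; if it had the role of the
  third mate in the other edge, the two edges would order these two mates in opposite ways. So
  the third mates agree, or they exchange roles with second mates in the third disjunct of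
  \<open>cross\<close>; both times the third coordinate of the centre is determined.
\<close>
lemma cross_centre_unique:
  assumes c: "cross p p1 p2 p3" and c': "cross p' p1' p2' p3'"
    and three: "3 \<le> card ({p, p1, p2, p3} \<inter> {p', p1', p2', p3'})"
  shows "p = p'"
proof -
  define e e' where "e = {p, p1, p2, p3}" and "e' = {p', p1', p2', p3'}"
  have fin: "finite e" "finite e'" "card e = 4" "card e' = 4"
    using cross_card[OF c] cross_card[OF c'] by (auto simp: e_def e'_def)
  have inj: "inj_on (\<lambda>a. (xc a, yc a)) e" "inj_on (\<lambda>a. (xc a, yc a)) e'"
    unfolding e_def e'_def by (rule cross_inj[OF c], rule cross_inj[OF c'])
  have x: "xc p = xc p'"
    using three fin cross_centre_position(1,2)[OF c] cross_centre_position(1,2)[OF c']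
    by (intro shared_minimum[of e 4 e' xc]) (simp_all add: e_def e'_def)
  have y: "yc p = yc p'"
    using three fin cross_centre_position(3,4)[OF c] cross_centre_position(3,4)[OF c']
    by (intro shared_median[of e e' yc]) (simp_all add: e_def e'_def)
  show ?thesis
  proof (cases "p \<in> e' \<or> p' \<in> e")
    case True
    moreover have "p \<in> e" "p' \<in> e'" by (simp_all add: e_def e'_def)
    moreover have "(xc p, yc p) = (xc p', yc p')" using x y by simp
    ultimately show ?thesis
      using inj_onD[OF inj(1), of p p'] inj_onD[OF inj(2), of p p'] by blast
  next
    case False
    have "card {p1, p2, p3} \<le> 3" "card {p1', p2', p3'} \<le> 3"
      by (simp_all add: card_insert_if)
    moreover have "e \<inter> e' = {p1, p2, p3} \<inter> {p1', p2', p3'}"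
      using False by (auto simp: e_def e'_def)
    then have "3 \<le> card ({p1, p2, p3} \<inter> {p1', p2', p3'})"
      using three unfolding e_def e'_def by simp
    ultimately have "{p1, p2, p3} \<inter> {p1', p2', p3'} = {p1, p2, p3}"
        "{p1, p2, p3} \<inter> {p1', p2', p3'} = {p1', p2', p3'}"
      by - (rule card_seteq; linarith?; force)+
    then have eq: "{p1, p2, p3} = {p1', p2', p3'}" by (rule trans[OF sym])
    have y1: "yc p1 \<noteq> yc p" "yc p1' \<noteq> yc p" "yc p2 = yc p" "yc p2' = yc p"
      using c c' y unfolding cross_def by auto
    have "zc p = zc p'"
    proof (cases "p1 = p1'")
      case True
      have "p2 \<noteq> p1" "p3 \<noteq> p1" "p2' \<noteq> p1" "p3' \<noteq> p1"
        using c c' True unfolding cross_def by auto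
      then have "{p2, p3} = {p2', p3'}" using eq True by blast
      then consider "p3 = p3'" | "p3 = p2'" "p2 = p3'" by (auto simp: doubleton_eq_iff)
      then show ?thesis
      proof cases
        case 1
        then show ?thesis using c c' unfolding cross_def by simp
      next
        case 2
        then have "yc p3 = yc p" using y1 by simp
        then show ?thesis using c c' 2 unfolding cross_def by auto
      qed
    next
      case False
      \<comment> \<open>The first disjunct would hold for both edges, and order the two mates in opposite ways.\<close>
      then have "p1 = p3'" using eq y1 by auto
      moreover have "p1' = p3" using eq y1 False by auto
      ultimately show ?thesis using c c' x y y1 unfolding cross_def by auto
    qed
    then show ?thesis using x y by (simp add: prod_eq_iff)
  qed
qed

text \<open>
  The third coordinate of the centre is a minimum attained twice. Each of the other coordinates is a
  value attained three times, which is a degenerate median.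
\<close>
lemma line_centre_unique:
  assumes l: "line p p1 p2 p3" and l': "line p' p1' p2' p3'"
    and three: "3 \<le> card ({p, p1, p2, p3} \<inter> {p', p1', p2', p3'})"
  shows "p = p'"
proof -
  define e e' where "e = {p, p1, p2, p3}" and "e' = {p', p1', p2', p3'}"
  have fin: "finite e" "finite e'" "card e = 4" "card e' = 4"
    using line_card[OF l] line_card[OF l'] by (auto simp: e_def e'_def)
  have z: "zc p = zc p'"
    using three fin line_centre_position(1,2)[OF l] line_centre_position(1,2)[OF l']
    by (intro shared_minimum[of e 4 e' zc]) (simp_all add: e_def e'_def)
  have maj: "3 \<le> card {a \<in> e. P a}" if "\<And>a. xc a = xc p \<and> yc a = yc p \<Longrightarrow> P a" for P
    by (rule order_trans[OF line_centre_position(3)[OF l] card_mono]) (use that fin in \<open>auto simp: e_def\<close>)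
  have maj': "3 \<le> card {a \<in> e'. P a}" if "\<And>a. xc a = xc p' \<and> yc a = yc p' \<Longrightarrow> P a" for P
    by (rule order_trans[OF line_centre_position(3)[OF l'] card_mono]) (use that fin in \<open>auto simp: e'_def\<close>)
  have three': "3 \<le> card (e \<inter> e')" using three by (simp add: e_def e'_def)
  have "xc p = xc p'"
    by (rule shared_median[OF fin(1,3,2,4) three']) (rule maj maj'; simp)+
  moreover have "yc p = yc p'"
    by (rule shared_median[OF fin(1,3,2,4) three']) (rule maj maj'; simp)+
  ultimately show ?thesis using z by (simp add: prod_eq_iff)
qed

text \<open>
  Any three points of a line edge include two on a vertical line, but a cross edge has no two such
  points.
\<close>
lemma cross_line_share_few:
  assumes c: "cross p p1 p2 p3" and l: "line p' p1' p2' p3'"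
  shows "card ({p, p1, p2, p3} \<inter> {p', p1', p2', p3'}) < 3"
proof (rule ccontr)
  define e D where "e = {p, p1, p2, p3}" and "D = {p', p1', p2'}"
  assume "\<not> ?thesis"
  then have "3 \<le> card (e \<inter> insert p3' D)"
    by (simp add: e_def D_def insert_commute)
  moreover have "card (e \<inter> insert p3' D) \<le> Suc (card (e \<inter> D))"
    by (auto simp: Int_insert_right card_insert_if e_def)
  ultimately have "2 \<le> card (e \<inter> D)" by simp
  moreover have "inj_on (\<lambda>a. (xc a, yc a)) (e \<inter> D)"
    using cross_inj[OF c] unfolding e_def by (rule inj_on_subset) auto
  then have "card (e \<inter> D) = card ((\<lambda>a. (xc a, yc a)) ` (e \<inter> D))"
    by (simp add: card_image)
  moreover have "(\<lambda>a. (xc a, yc a)) ` (e \<inter> D) \<subseteq> {(xc p', yc p')}"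
    using l by (auto simp: D_def line_def)
  then have "card ((\<lambda>a. (xc a, yc a)) ` (e \<inter> D)) \<le> card {(xc p', yc p')}"
    by (intro card_mono) auto
  ultimately show False by simp
qed

lemma grid_is_rgraph: "is_rgraph 4 (grid_hypergraph q)"
  unfolding is_rgraph_def
proof (intro conjI ballI)
  fix e assume "e \<in> edges (grid_hypergraph q)"
  then obtain p p1 p2 p3 where e: "e = {p, p1, p2, p3}" "e \<subseteq> {..<q} \<times> {..<q} \<times> {..<q}"
    "cross p p1 p2 p3 \<or> line p p1 p2 p3"
    unfolding grid_hypergraph_def hypergraph.simps by blast
  show "e \<subseteq> verts (grid_hypergraph q)" using e(2) by (simp add: grid_hypergraph_def)
  show "card e = 4" using e(3) cross_card line_card unfolding e(1) by blast
qed (simp add: grid_hypergraph_def)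

lemma grid_star_components: "star_components 4 (grid_hypergraph q)"
proof -
  define C where "C p e \<longleftrightarrow> (\<exists>p1 p2 p3. e = {p, p1, p2, p3} \<and> (cross p p1 p2 p3 \<or> line p p1 p2 p3))"
    for p e
  show ?thesis
    unfolding star_components_def
  proof (intro exI[of _ C] conjI ballI allI impI)
    fix e assume "e \<in> edges (grid_hypergraph q)"
    then obtain p p1 p2 p3 where "e = {p, p1, p2, p3}" "cross p p1 p2 p3 \<or> line p p1 p2 p3"
      unfolding grid_hypergraph_def hypergraph.simps by blast
    then show "\<exists>p\<in>e. C p e" unfolding C_def by blast
  next
    fix e e' p p'
    assume C: "C p e" "C p' e'" and "4 \<le> Suc (card (e \<inter> e'))"
    then have three: "3 \<le> card (e \<inter> e')" by simp
    obtain p1 p2 p3 where e: "e = {p, p1, p2, p3}" "cross p p1 p2 p3 \<or> line p p1 p2 p3"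
      using C(1) unfolding C_def by blast
    obtain p1' p2' p3' where e': "e' = {p', p1', p2', p3'}" "cross p' p1' p2' p3' \<or> line p' p1' p2' p3'"
      using C(2) unfolding C_def by blast
    have t: "3 \<le> card ({p, p1, p2, p3} \<inter> {p', p1', p2', p3'})"
      "3 \<le> card ({p', p1', p2', p3'} \<inter> {p, p1, p2, p3})"
      using three unfolding e(1) e'(1) by (simp_all only: Int_commute)
    show "p = p'"
      using e(2) e'(2)
    proof (elim disjE)
      assume "cross p p1 p2 p3" "cross p' p1' p2' p3'"
      then show ?thesis using t(1) by (rule cross_centre_unique)
    next
      assume "line p p1 p2 p3" "line p' p1' p2' p3'"
      then show ?thesis using t(1) by (rule line_centre_unique)
    next
      assume "cross p p1 p2 p3" "line p' p1' p2' p3'"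
      then show ?thesis using cross_line_share_few t(1) by (meson not_le)
    next
      assume "line p p1 p2 p3" "cross p' p1' p2' p3'"
      then show ?thesis using cross_line_share_few t(2) by (meson not_le)
    qed
  qed
qed

text \<open>
  A point is the centre of a cross edge unless it is extremal in one of five ways: without larger \<open>x\<close>
  in its \<open>y\<close>-slice (needed for \<open>p2\<close>), with largest or smallest \<open>y\<close> in its \<open>x\<close>-slice (needed for \<open>p1\<close>,
  on the side opposite to \<open>p3\<close>), or among the two lexicographically largest in its \<open>z\<close>-slice
  (needed for \<open>p3\<close>). Two larger points are required there because a single one may have the same
  \<open>y\<close> as the centre; if both have it, they serve together as \<open>p2\<close> and \<open>p3\<close>.
\<close>
lemma cross_free_card:
  assumes S: "S \<subseteq> {..<q} \<times> {..<q} \<times> {..<q}" and inj: "inj_on (\<lambda>a. (xc a, yc a)) S"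
    and free: "\<And>p p1 p2 p3. p \<in> S \<Longrightarrow> p1 \<in> S \<Longrightarrow> p2 \<in> S \<Longrightarrow> p3 \<in> S \<Longrightarrow> \<not> cross p p1 p2 p3"
  shows "card S \<le> 5 * q"
proof -
  have fin: "finite S" using S by (rule finite_subset) simp
  have eqI: "a = b" if "a \<in> S" "b \<in> S" "xc a = xc b" "yc a = yc b" for a b
    using inj_onD[OF inj _ that(1,2)] that by simp
  define lex where "lex a b \<longleftrightarrow> xc a < xc b \<or> xc a = xc b \<and> yc a < yc b" for a b :: point
  define A where "A = {p \<in> S. \<not> (\<exists>s\<in>S. yc s = yc p \<and> xc p < xc s)}"
  define B where "B = {p \<in> S. \<not> (\<exists>s\<in>S. xc s = xc p \<and> yc p < yc s)}"
  define B' where "B' = {p \<in> S. \<not> (\<exists>s\<in>S. xc s = xc p \<and> yc s < yc p)}"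
  define M where "M = {p \<in> S. \<not> (\<exists>s\<in>S. zc s = zc p \<and> lex p s)}"
  define M' where "M' = {p \<in> S - M. \<not> (\<exists>s\<in>S - M. zc s = zc p \<and> lex p s)}"
  have range: "xc ` S \<subseteq> {..<q}" "yc ` S \<subseteq> {..<q}" "zc ` S \<subseteq> {..<q}"
    using S by auto
  have lex_total: "lex a b \<or> lex b a" if "a \<in> S" "b \<in> S" "a \<noteq> b" for a b
    using eqI[OF that(1,2)] that(3) unfolding lex_def by linarith
  have y_total: "xc a < xc b \<or> xc b < xc a" if "a \<in> S" "b \<in> S" "a \<noteq> b" "yc a = yc b" for a b
    using eqI[OF that(1,2)] that(3,4) by linarith
  have x_total: "yc a < yc b \<or> yc b < yc a" if "a \<in> S" "b \<in> S" "a \<noteq> b" "xc a = xc b" for a b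
    using eqI[OF that(1,2)] that(3,4) by linarith
  have "card A \<le> q"
    unfolding A_def using card_fibre_maximal_le[OF fin range(2) finite_lessThan, of "\<lambda>a b. xc a < xc b"] y_total
    by simp
  moreover have "card B \<le> q"
    unfolding B_def using card_fibre_maximal_le[OF fin range(1) finite_lessThan, of "\<lambda>a b. yc a < yc b"] x_total
    by simp
  moreover have "card B' \<le> q"
    unfolding B'_def using card_fibre_maximal_le[OF fin range(1) finite_lessThan, of "\<lambda>a b. yc b < yc a"] x_total
    by simp
  moreover have "card M \<le> q"
    unfolding M_def using card_fibre_maximal_le[OF fin range(3) finite_lessThan, of lex] lex_total
    by simp
  moreover have "card M' \<le> q"
    unfolding M'_def
    using card_fibre_maximal_le[of "S - M" zc "{..<q}" lex] fin range(3) lex_total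
    by (simp add: image_subset_iff)
  moreover have "S \<subseteq> A \<union> B \<union> B' \<union> M \<union> M'"
  proof (rule ccontr)
    assume "\<not> ?thesis"
    then obtain p where p: "p \<in> S" "p \<notin> A" "p \<notin> B" "p \<notin> B'" "p \<notin> M" "p \<notin> M'" by blast
    obtain a where a: "a \<in> S" "yc a = yc p" "xc p < xc a" using p by (auto simp: A_def)
    obtain b where b: "b \<in> S" "xc b = xc p" "yc p < yc b" using p by (auto simp: B_def)
    obtain b' where b': "b' \<in> S" "xc b' = xc p" "yc b' < yc p" using p by (auto simp: B'_def)
    obtain u where u: "u \<in> S - M" "zc u = zc p" "lex p u" using p by (auto simp: M'_def)
    obtain w where w: "w \<in> S" "zc w = zc u" "lex u w" using u(1) by (auto simp: M_def)
    have lex_u: "\<exists>p1\<in>S. cross p p1 a v"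
      if v: "v \<in> S" "zc v = zc p" "lex p v" "yc v \<noteq> yc p" for v
    proof (cases "yc v < yc p")
      case True
      then have "cross p b a v" using v a b unfolding cross_def lex_def by auto
      then show ?thesis using b by blast
    next
      case False
      then have "cross p b' a v" using v a b' unfolding cross_def lex_def by auto
      then show ?thesis using b' by blast
    qed
    have "lex p w" using u(3) w(3) unfolding lex_def by auto
    then consider "yc u \<noteq> yc p" | "yc w \<noteq> yc p" | "yc u = yc p" "yc w = yc p" by blast
    then show False
    proof cases
      case 1
      then show False using lex_u[of u] u free p(1) a(1) by blast
    next
      case 2
      then show False using lex_u[of w] \<open>lex p w\<close> u w free p(1) a(1) by metis
    next
      case 3
      then have "cross p b u w" using b u w unfolding cross_def lex_def by auto
      then show False using free p(1) b(1) u(1) w(1) by blast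
    qed
  qed
  then have "card S \<le> card (A \<union> B \<union> B' \<union> M \<union> M')"
    using fin by (intro card_mono) (auto simp: A_def B_def B'_def M_def M'_def)
  moreover have "\<dots> \<le> card A + card B + card B' + card M + card M'"
    by (meson add_le_mono1 card_Un_le order_trans)
  ultimately show ?thesis by linarith
qed

text \<open>
  The topmost points of all vertical lines, and the second ones from the top, form two sets to which
  \<open>cross_free_card\<close> applies. Every other point has two points of \<open>S\<close> above it, so without a line
  edge it must be the only such point at its height.
\<close>
lemma grid_independent_card:
  assumes indep: "independent_set (grid_hypergraph q) S"
  shows "card S \<le> 11 * q"
proof -
  have S: "S \<subseteq> {..<q} \<times> {..<q} \<times> {..<q}"
    using indep by (simp add: independent_set_def grid_hypergraph_def)
  then have fin: "finite S" by (rule finite_subset) simp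
  have free: "\<not> cross p p1 p2 p3 \<and> \<not> line p p1 p2 p3"
    if "p \<in> S" "p1 \<in> S" "p2 \<in> S" "p3 \<in> S" for p p1 p2 p3
  proof (rule ccontr)
    assume "\<not> ?thesis"
    moreover have sub: "{p, p1, p2, p3} \<subseteq> S" using that by simp
    ultimately have "{p, p1, p2, p3} \<in> edges (grid_hypergraph q)"
      using S unfolding grid_hypergraph_def hypergraph.simps by blast
    then show False using indep sub unfolding independent_set_def by blast
  qed
  define above where "above p s \<longleftrightarrow> xc s = xc p \<and> yc s = yc p \<and> zc p < zc s" for p s :: point
  define M where "M = {p \<in> S. \<not> (\<exists>s\<in>S. above p s)}"
  define M' where "M' = {p \<in> S - M. \<not> (\<exists>s\<in>S - M. above p s)}"
  define R where "R = S - M - M'"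
  have total: "above a b \<or> above b a" if "xc a = xc b" "yc a = yc b" "a \<noteq> b" for a b
    using that by (auto simp: above_def prod_eq_iff)
  have "inj_on (\<lambda>a. (xc a, yc a)) M"
  proof (rule inj_onI, rule ccontr)
    fix a b assume "a \<in> M" "b \<in> M" "(xc a, yc a) = (xc b, yc b)" "a \<noteq> b"
    then show False using total[of a b] unfolding M_def by auto
  qed
  then have "card M \<le> 5 * q"
    using S free by (intro cross_free_card) (auto simp: M_def)
  moreover have "inj_on (\<lambda>a. (xc a, yc a)) M'"
  proof (rule inj_onI, rule ccontr)
    fix a b assume "a \<in> M'" "b \<in> M'" "(xc a, yc a) = (xc b, yc b)" "a \<noteq> b"
    then show False using total[of a b] unfolding M'_def by auto
  qed
  then have "card M' \<le> 5 * q"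
    using S free by (intro cross_free_card) (auto simp: M'_def)
  moreover have "inj_on zc R"
  proof (rule inj_onI, rule ccontr)
    fix s p assume *: "s \<in> R" "p \<in> R" "zc s = zc p" "s \<noteq> p"
    obtain u where u: "u \<in> S - M" "above p u" using *(2) by (auto simp: R_def M'_def)
    obtain w where w: "w \<in> S" "above u w" using u(1) by (auto simp: M_def)
    have "line p u w s" using * u w by (auto simp: line_def above_def)
    then show False using free[of p u w s] * u w by (auto simp: R_def)
  qed
  then have "card R \<le> card {..<q}"
    using S by (intro card_inj_on_le[of zc]) (auto simp: R_def)
  moreover have "S = R \<union> M \<union> M'"
    by (auto simp: R_def M_def M'_def)
  then have "card S \<le> card R + card M + card M'"
    by (metis (no_types, lifting) add_le_mono1 card_Un_le order_trans)
  ultimately show ?thesis by simp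
qed

lemma ramsey_number_gt_power:
  assumes r: "r \<in> {3, 4}" and T: "tight_tree r T" "nontrivial_hypergraph T" and n: "11 * q < n"
  shows "q ^ (r - 1) < ramsey_number r T n"
  using r
proof (elim insertE emptyE)
  assume [simp]: "r = 3"
  have "card S < n" if "independent_set (corner_hypergraph q) S" for S
    using corner_independent_card[OF that] n by linarith
  then have "card (verts (corner_hypergraph q)) < ramsey_number r T n"
    using T corner_is_rgraph corner_star_components by (intro ramsey_number_gt) auto
  then show ?thesis by (simp add: corner_hypergraph_def card_cartesian_product power2_eq_square)
next
  assume [simp]: "r = 4"
  have "card S < n" if "independent_set (grid_hypergraph q) S" for S
    using grid_independent_card[OF that] n by linarith
  then have "card (verts (grid_hypergraph q)) < ramsey_number r T n"
    using T grid_is_rgraph grid_star_components by (intro ramsey_number_gt) auto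
  then show ?thesis by (simp add: grid_hypergraph_def card_cartesian_product power3_eq_cube)
qed

text \<open>
  With \<open>q\<close> the largest number such that \<open>11 * q < n\<close>, the quotient \<open>n / 22\<close> is at most \<open>q\<close>, or at
  most \<open>1\<close> if \<open>q = 0\<close>.
\<close>
lemma ramsey_number_lower:
  assumes "r \<in> {3, 4}" "tight_tree r T" "nontrivial_hypergraph T" "n > 0"
  shows "(1 / 22) ^ (r - 1) * real n ^ (r - 1) \<le> real (ramsey_number r T n)"
proof -
  define q where "q = (n - 1) div 11"
  have q: "11 * q < n" "n \<le> 11 * (q + 1)" using assms(4) by (auto simp: q_def)
  have R: "q ^ (r - 1) + 1 \<le> ramsey_number r T n"
    using ramsey_number_gt_power[OF assms(1-3) q(1)] by simp
  have "(1 / 22) ^ (r - 1) * real n ^ (r - 1) = (real n / 22) ^ (r - 1)"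
    by (simp add: power_divide)
  also have "\<dots> \<le> real q ^ (r - 1) + 1"
  proof (cases "q = 0")
    case True
    then have "(real n / 22) ^ (r - 1) \<le> 1" using q by (intro power_le_one) auto
    then show ?thesis by (simp add: add_increasing)
  next
    case False
    then have "n \<le> 22 * q" using q(2) by (cases q) auto
    then have "(real n / 22) ^ (r - 1) \<le> real q ^ (r - 1)" by (intro power_mono) auto
    then show ?thesis by simp
  qed
  also have "\<dots> \<le> real (ramsey_number r T n)"
    using R of_nat_mono[OF R, where 'a = real] by simp
  finally show ?thesis .
qed

text \<open>
  The last summand of the constant leaves room for those vertices of \<open>T\<close> that lie in no edge; the
  other two are what the averaging argument requires.
\<close>
lemma ramsey_number_upper:
  assumes T: "tight_tree r T" and r: "2 \<le> r" and n: "n > 0"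
  shows "ramsey_number r T n \<le> (card (verts T) * r ^ Suc r + r + card (verts T)) * n ^ (r - 1)"
    (is "_ \<le> ?N")
  unfolding ramsey_number_def
proof (rule Least_le, unfold ramsey_property_def, intro allI impI, elim conjE)
  fix H :: "nat hypergraph"
  assume H: "is_rgraph r H" "card (verts H) = ?N" "hypergraph_free r T H"
  define k where "k = card (verts T)"
  have "n ^ 1 \<le> n ^ (r - 1)" using r n by (intro power_increasing) auto
  then have "n \<le> n ^ (r - 1)" "1 \<le> n ^ (r - 1)" using n by auto
  then have "k * 1 \<le> k * n ^ (r - 1)" "r * n \<le> r * n ^ (r - 1)"
    by (intro mult_le_mono2; simp)+
  moreover have "?N = k * r ^ Suc r * n ^ (r - 1) + r * n ^ (r - 1) + k * n ^ (r - 1)"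
    by (simp add: k_def add_mult_distrib)
  ultimately have "k \<le> card (verts H)" "k * r ^ Suc r * n ^ (r - 1) + r * n \<le> card (verts H)"
    using H(2) by linarith+
  then show "\<exists>S. independent_set H S \<and> card S = n"
    using tight_tree_free_few_edges[OF T _ H(1,3)] r
    by (intro sparse_rgraph_independent_set[OF H(1) r n, of k]) (simp_all add: k_def)
qed

theorem theorem1p1:
  fixes r :: nat and T :: "'a hypergraph"
  assumes "r \<in> {3, 4}"
    and "tight_tree r T"
    and "nontrivial_hypergraph T"
  shows "\<exists>c1 c2 :: real. c1 > 0 \<and> c2 > 0 \<and>
           (\<forall>n :: nat. n > 0 \<longrightarrow>
              c1 * real n ^ (r - 1) \<le> real (ramsey_number r T n) \<and>
              real (ramsey_number r T n) \<le> c2 * real n ^ (r - 1))"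
proof (intro exI conjI allI impI)
  let ?c = "card (verts T) * r ^ Suc r + r + card (verts T)"
  have r: "2 \<le> r" using assms(1) by auto
  show "(1 / 22 :: real) ^ (r - 1) > 0" by simp
  show "real ?c > 0" unfolding of_nat_0_less_iff using r by simp
  fix n :: nat assume n: "n > 0"
  show "(1 / 22) ^ (r - 1) * real n ^ (r - 1) \<le> real (ramsey_number r T n)"
    using assms n by (rule ramsey_number_lower)
  have "real (ramsey_number r T n) \<le> real (?c * n ^ (r - 1))"
    using ramsey_number_upper[OF assms(2) r n] by (rule of_nat_mono)
  then show "real (ramsey_number r T n) \<le> real ?c * real n ^ (r - 1)" by simp
qed

end
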